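(* Let $d\ge1$, let $\mathcal{X},\mathcal{Y}_1,\dots,\mathcal{Y}_d$ be Banach spaces over $\mathbb{F}$, and let $\mathcal{T}=(T_1,\dots,T_d)$ and $\mathcal{S}=(S_1,\dots,S_d)$ belong to $\mathcal{L}(\mathcal{X},\ell_\infty^d(\mathcal{Y}_k))$. Then \[\rho_+(\mathcal{T},\mathcal{S})=\max\{\rho_+(T_i,S_i):1\le i\le d,\ \|T_i\|=\|\mathcal{T}\|\},\] \[\rho_-(\mathcal{T},\mathcal{S})=\min\{\rho_-(T_i,S_i):1\le i\le d,\ \|T_i\|=\|\mathcal{T}\|\}.\]
   Context: $\mathbb{F}$ is $\mathbb{R}$ or $\mathbb{C}$. $\ell_\infty^d(\mathcal{Y}_k)$ is the direct sum $\mathcal{Y}_1\oplus\cdots\oplus\mathcal{Y}_d$ with norm $\|(y_1,\dots,y_d)\|_\infty=\max_{1\le i\le d}\|y_i\|$. $\mathcal{L}(\mathcal{X},\mathcal{Y})$ is the space of bounded linear operators from $\mathcal{X}$ to $\mathcal{Y}$ with the operator norm. A tuple $\mathcal{T}=(T_1,\dots,T_d)$ with $T_k\in\mathcal{L}(\mathcal{X},\mathcal{Y}_k)$ is identified with the operator $x\mapsto(T_1x,\dots,T_dx)$ into $\ell_\infty^d(\mathcal{Y}_k)$, and $\|\mathcal{T}\|$ is its operator norm. For elements $x,y$ of a Banach space, the one-sided G\^ateaux derivatives of the norm at $x$ in the direction $y$ are $\rho_+(x,y)=\lim_{t\to0+}\frac{\|x+ty\|-\|x\|}{t}$ and $\rho_-(x,y)=\lim_{t\to0-}\frac{\|x+ty\|-\|x\|}{t}$;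 here they are taken in $\mathcal{L}(\mathcal{X},\ell_\infty^d(\mathcal{Y}_k))$ for $(\mathcal{T},\mathcal{S})$ and in $\mathcal{L}(\mathcal{X},\mathcal{Y}_i)$ for $(T_i,S_i)$. *)

theory Defs
  imports "HOL-Analysis.Analysis" "HOL-Algebra.Module"
begin

text \<open>
  A type of this class is a copy of the real or of the complex numbers. The absolute value of the
  scalars is \<^const>\<open>norm\<close>; since it is multiplicative and extends the one of the real numbers,
  it is the usual one.
\<close>

class real_or_complex = real_normed_field +
  assumes real_or_complex:
    "(\<forall>z. \<exists>a. z = a *\<^sub>R 1) \<or>
     (\<exists>i. i * i = - 1 \<and> (\<forall>z. \<exists>a b. z = a *\<^sub>R 1 + b *\<^sub>R i))"

instance real :: real_or_complex
  by standard auto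

instance complex :: real_or_complex
proof
  have "\<i> * \<i> = - 1 \<and> (\<forall>z. \<exists>a b. z = a *\<^sub>R 1 + b *\<^sub>R \<i>)"
    by (metis complex_eq i_squared mult.commute scaleR_conv_of_real mult.right_neutral)
  then show "(\<forall>z::complex. \<exists>a. z = a *\<^sub>R 1) \<or>
     (\<exists>i::complex. i * i = - 1 \<and> (\<forall>z. \<exists>a b. z = a *\<^sub>R 1 + b *\<^sub>R i))"
    by blast
qed

definition scalars :: "'k::real_or_complex ring" where
  "scalars = \<lparr>carrier = UNIV, mult = (*), one = 1, zero = 0, add = (+)\<rparr>"

lemma scalars_simps [simp]:
  "carrier scalars = UNIV" "mult scalars = (*)" "one scalars = 1"
  "zero scalars = 0" "add scalars = (+)"
  by (simp_all add: scalars_def)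

lemma cring_scalars: "cring (scalars :: 'k::real_or_complex ring)"
proof (rule cringI)
  show "abelian_group (scalars :: 'k ring)"
  proof (rule abelian_groupI)
    fix x :: 'k
    show "\<exists>y\<in>carrier scalars. y \<oplus>\<^bsub>scalars\<^esub> x = \<zero>\<^bsub>scalars\<^esub>"
      by (rule bexI[of _ "- x"]) auto
  qed (auto simp: ac_simps)
  show "comm_monoid (scalars :: 'k ring)"
    by (rule comm_monoidI) (auto simp: ac_simps)
qed (auto simp: algebra_simps)

text \<open>
  The summands of a direct sum are different spaces indexed by a number, so a space is a structure
  with an explicit carrier. Letting the carriers of the summands lie in one type is no restriction:
  a finite family can be transported into the sum of its types. The fields \<^const>\<open>mult\<close> and \<^const>\<open>one\<close> that the
  record \<open>module\<close> inherits from \<open>ring\<close> carry no meaning here.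
\<close>

record ('k, 'a) normed = "('k, 'a) module" +
  vnorm :: "'a \<Rightarrow> real"

text \<open>The metric takes the value 0 off the carrier, as \<^locale>\<open>Metric_space\<close> needs
  it to be symmetric and nonnegative on the whole type.\<close>

definition vdist :: "('k, 'a, 'm) normed_scheme \<Rightarrow> 'a \<Rightarrow> 'a \<Rightarrow> real" where
  "vdist V x y = (if x \<in> carrier V \<and> y \<in> carrier V then vnorm V (x \<ominus>\<^bsub>V\<^esub> y) else 0)"

locale normed_space = Module.module scalars V
  for V :: "('k::real_or_complex, 'a, 'm) normed_scheme" (structure) +
  assumes vnorm_nonneg: "x \<in> carrier V \<Longrightarrow> 0 \<le> vnorm V x"
    and vnorm_eq_0_iff: "x \<in> carrier V \<Longrightarrow> vnorm V x = 0 \<longleftrightarrow> x = \<zero>"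
    and vnorm_smult: "x \<in> carrier V \<Longrightarrow> vnorm V (c \<odot>\<^bsub>V\<^esub> x) = norm c * vnorm V x"
    and vnorm_triangle:
      "\<lbrakk>x \<in> carrier V; y \<in> carrier V\<rbrakk> \<Longrightarrow> vnorm V (x \<oplus> y) \<le> vnorm V x + vnorm V y"
begin

lemma minus_eq_zero_iff: "\<lbrakk>x \<in> carrier V; y \<in> carrier V\<rbrakk> \<Longrightarrow> x \<ominus> y = \<zero> \<longleftrightarrow> x = y"
  by (metis M.a_inv_closed M.minus_eq M.minus_equality M.minus_minus M.r_neg)

lemma smult_minus_one: "x \<in> carrier V \<Longrightarrow> (- 1) \<odot>\<^bsub>V\<^esub> x = \<ominus> x"
proof -
  assume x: "x \<in> carrier V"
  have "(- 1) \<odot>\<^bsub>V\<^esub> x \<oplus> x = (- 1 \<oplus>\<^bsub>scalars\<^esub> 1) \<odot>\<^bsub>V\<^esub> x"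
    using x smult_l_distr[of "- 1" 1 x] smult_one[of x] by simp
  also have "\<dots> = \<zero>"
    using x smult_l_null[of x] by simp
  finally show ?thesis
    using x smult_closed[of "- 1" x] M.minus_equality by (metis UNIV_I scalars_simps(1))
qed

lemma vnorm_minus: "x \<in> carrier V \<Longrightarrow> vnorm V (\<ominus> x) = vnorm V x"
  using vnorm_smult[of x "- 1"] smult_minus_one[of x] by simp

sublocale Metric_space "carrier V" "vdist V"
proof
  show "0 \<le> vdist V x y" for x y
    by (simp add: vdist_def vnorm_nonneg)
  show "vdist V x y = vdist V y x" for x y
  proof (cases "x \<in> carrier V \<and> y \<in> carrier V")
    case True
    then have "\<ominus> (x \<ominus> y) = y \<ominus> x"
      by (simp add: a_minus_def M.minus_add M.a_comm)
    with True vnorm_minus[of "x \<ominus> y"] show ?thesis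
      by (simp add: vdist_def)
  qed (auto simp: vdist_def)
  show "vdist V x y = 0 \<longleftrightarrow> x = y" if "x \<in> carrier V" "y \<in> carrier V" for x y
    using that vnorm_eq_0_iff[of "x \<ominus> y"] minus_eq_zero_iff by (simp add: vdist_def)
  show "vdist V x z \<le> vdist V x y + vdist V y z"
    if "x \<in> carrier V" "y \<in> carrier V" "z \<in> carrier V" for x y z
  proof -
    have "x \<ominus> z = (x \<ominus> y) \<oplus> (y \<ominus> z)"
      using that by (simp add: a_minus_def M.a_assoc M.r_neg1)
    then show ?thesis
      using that vnorm_triangle[of "x \<ominus> y" "y \<ominus> z"] by (simp add: vdist_def)
  qed
qed

end

locale banach_space = normed_space +
  assumes complete: "Metric_space.mcomplete (carrier V) (vdist V)"

text \<open>An element of the sum of \<open>Y 1, \<dots>, Y d\<close> is a function on \<open>{1..d}\<close>,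
  extended by \<^const>\<open>undefined\<close>.\<close>

definition linf_sum ::
  "nat \<Rightarrow> (nat \<Rightarrow> ('k, 'b) normed) \<Rightarrow> ('k, nat \<Rightarrow> 'b) normed" where
  "linf_sum d Y =
    \<lparr>carrier = (\<Pi>\<^sub>E i\<in>{1..d}. carrier (Y i)),
     mult = undefined, one = undefined,
     zero = (\<lambda>i\<in>{1..d}. \<zero>\<^bsub>Y i\<^esub>),
     add = (\<lambda>y z. \<lambda>i\<in>{1..d}. y i \<oplus>\<^bsub>Y i\<^esub> z i),
     smult = (\<lambda>c y. \<lambda>i\<in>{1..d}. c \<odot>\<^bsub>Y i\<^esub> y i),
     vnorm = (\<lambda>y. Max {vnorm (Y i) (y i) | i. i \<in> {1..d}})\<rparr>"

definition bounded_linear_on ::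
  "('k, 'a) normed \<Rightarrow> ('k, 'b) normed \<Rightarrow> ('a \<Rightarrow> 'b) \<Rightarrow> bool" where
  "bounded_linear_on X Y T \<longleftrightarrow>
    T \<in> carrier X \<rightarrow> carrier Y \<and>
    (\<forall>x\<in>carrier X. \<forall>y\<in>carrier X. T (x \<oplus>\<^bsub>X\<^esub> y) = T x \<oplus>\<^bsub>Y\<^esub> T y) \<and>
    (\<forall>c. \<forall>x\<in>carrier X. T (c \<odot>\<^bsub>X\<^esub> x) = c \<odot>\<^bsub>Y\<^esub> T x) \<and>
    (\<exists>K. \<forall>x\<in>carrier X. vnorm Y (T x) \<le> K * vnorm X x)"

definition opnorm :: "('k, 'a) normed \<Rightarrow> ('k, 'b) normed \<Rightarrow> ('a \<Rightarrow> 'b) \<Rightarrow> real" where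
  "opnorm X Y T = (SUP x\<in>{x \<in> carrier X. vnorm X x \<le> 1}. vnorm Y (T x))"

text \<open>Operators are extended by \<^const>\<open>undefined\<close> off the carrier of the domain, so
  that equality of operators is equality of functions.\<close>

definition operator_space ::
  "('k, 'a) normed \<Rightarrow> ('k, 'b) normed \<Rightarrow> ('k, 'a \<Rightarrow> 'b) normed" where
  "operator_space X Y =
    \<lparr>carrier = {T \<in> extensional (carrier X). bounded_linear_on X Y T},
     mult = undefined, one = undefined,
     zero = (\<lambda>x\<in>carrier X. \<zero>\<^bsub>Y\<^esub>),
     add = (\<lambda>S T. \<lambda>x\<in>carrier X. S x \<oplus>\<^bsub>Y\<^esub> T x),
     smult = (\<lambda>c T. \<lambda>x\<in>carrier X. c \<odot>\<^bsub>Y\<^esub> T x),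
     vnorm = opnorm X Y\<rparr>"

definition tuple_operator ::
  "('k, 'a) normed \<Rightarrow> nat \<Rightarrow> (nat \<Rightarrow> 'a \<Rightarrow> 'b) \<Rightarrow> 'a \<Rightarrow> nat \<Rightarrow> 'b" where
  "tuple_operator X d T = (\<lambda>x\<in>carrier X. \<lambda>i\<in>{1..d}. T i x)"

definition rho_plus :: "('k::real_or_complex, 'a, 'm) normed_scheme \<Rightarrow> 'a \<Rightarrow> 'a \<Rightarrow> real" where
  "rho_plus V x y =
    Lim (at_right 0) (\<lambda>t. (vnorm V (x \<oplus>\<^bsub>V\<^esub> of_real t \<odot>\<^bsub>V\<^esub> y) - vnorm V x) / t)"

definition rho_minus :: "('k::real_or_complex, 'a, 'm) normed_scheme \<Rightarrow> 'a \<Rightarrow> 'a \<Rightarrow> real" where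
  "rho_minus V x y =
    Lim (at_left 0) (\<lambda>t. (vnorm V (x \<oplus>\<^bsub>V\<^esub> of_real t \<odot>\<^bsub>V\<^esub> y) - vnorm V x) / t)"

text \<open>By convexity both limits exist in a normed space, so that \<^const>\<open>Lim\<close> is meaningful
  (\<open>rho_plus_limit\<close>, \<open>rho_minus_limit\<close>).\<close>

context normed_space
begin

lemma smult_zero_left: "x \<in> carrier V \<Longrightarrow> 0 \<odot>\<^bsub>V\<^esub> x = \<zero>"
  using smult_l_null[of x] by simp

lemma quotient_mono:
  assumes x: "x \<in> carrier V" and y: "y \<in> carrier V" and s: "0 < s" and t: "s \<le> t"
  shows "(vnorm V (x \<oplus> of_real s \<odot>\<^bsub>V\<^esub> y) - vnorm V x) / s
       \<le> (vnorm V (x \<oplus> of_real t \<odot>\<^bsub>V\<^esub> y) - vnorm V x) / t"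
proof -
  define l where "l = s / t"
  have l: "0 \<le> l" "l \<le> 1" "l * t = s" "0 < t"
    using s t by (auto simp: l_def)
  have sm: "c \<odot>\<^bsub>V\<^esub> z \<in> carrier V" if "z \<in> carrier V" for c z
    using that by simp
  have lt: "of_real l * of_real t = (of_real s :: 'k)"
    using l(3) by (metis of_real_mult)
  have "of_real (1 - l) \<odot>\<^bsub>V\<^esub> x \<oplus> of_real l \<odot>\<^bsub>V\<^esub> (x \<oplus> of_real t \<odot>\<^bsub>V\<^esub> y)
      = of_real (1 - l) \<odot>\<^bsub>V\<^esub> x \<oplus> (of_real l \<odot>\<^bsub>V\<^esub> x \<oplus> of_real s \<odot>\<^bsub>V\<^esub> y)"
    using x y sm smult_r_distr[of "of_real l" x "of_real t \<odot>\<^bsub>V\<^esub> y"]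
      smult_assoc1[of "of_real l" "of_real t" y] lt by simp
  also have "\<dots> = (of_real (1 - l) \<odot>\<^bsub>V\<^esub> x \<oplus> of_real l \<odot>\<^bsub>V\<^esub> x) \<oplus> of_real s \<odot>\<^bsub>V\<^esub> y"
    using x y sm by (simp add: M.a_assoc)
  also have "of_real (1 - l) \<odot>\<^bsub>V\<^esub> x \<oplus> of_real l \<odot>\<^bsub>V\<^esub> x = x"
    using x smult_l_distr[of "of_real (1 - l)" "of_real l" x] smult_one[of x] by simp
  finally have "vnorm V (x \<oplus> of_real s \<odot>\<^bsub>V\<^esub> y)
      \<le> (1 - l) * vnorm V x + l * vnorm V (x \<oplus> of_real t \<odot>\<^bsub>V\<^esub> y)"
    using x y sm l vnorm_triangle[of "of_real (1 - l) \<odot>\<^bsub>V\<^esub> x"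
        "of_real l \<odot>\<^bsub>V\<^esub> (x \<oplus> of_real t \<odot>\<^bsub>V\<^esub> y)"]
      vnorm_smult[of x "of_real (1 - l)"]
      vnorm_smult[of "x \<oplus> of_real t \<odot>\<^bsub>V\<^esub> y" "of_real l"]
    by (simp del: of_real_diff)
  then have "vnorm V (x \<oplus> of_real s \<odot>\<^bsub>V\<^esub> y) - vnorm V x
      \<le> l * (vnorm V (x \<oplus> of_real t \<odot>\<^bsub>V\<^esub> y) - vnorm V x)"
    by (simp add: algebra_simps)
  then show ?thesis
    using s l by (simp add: l_def field_simps)
qed

lemma quotient_ge:
  assumes x: "x \<in> carrier V" and y: "y \<in> carrier V" and t: "0 < t"
  shows "- vnorm V y \<le> (vnorm V (x \<oplus> of_real t \<odot>\<^bsub>V\<^esub> y) - vnorm V x) / t"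
proof -
  let ?u = "of_real t \<odot>\<^bsub>V\<^esub> y"
  have u: "?u \<in> carrier V" using y by simp
  have "x = (x \<oplus> ?u) \<oplus> \<ominus> ?u"
    using x u by (simp add: M.a_assoc M.r_neg)
  then have "vnorm V x \<le> vnorm V (x \<oplus> ?u) + t * vnorm V y"
    using x u y t vnorm_triangle[of "x \<oplus> ?u" "\<ominus> ?u"] vnorm_minus[of ?u]
      vnorm_smult[of y "of_real t"] by simp
  then show ?thesis
    using t by (simp add: field_simps)
qed

lemma right_limit_exists:
  assumes x: "x \<in> carrier V" and y: "y \<in> carrier V"
  shows "\<exists>l. ((\<lambda>t. (vnorm V (x \<oplus> of_real t \<odot>\<^bsub>V\<^esub> y) - vnorm V x) / t) \<longlongrightarrow> l) (at_right 0)"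
proof -
  define q where "q = (\<lambda>t. (vnorm V (x \<oplus> of_real t \<odot>\<^bsub>V\<^esub> y) - vnorm V x) / t)"
  have bdd: "bdd_below (q ` {0<..})"
    by (rule bdd_belowI2[of _ "- vnorm V y"]) (use quotient_ge[OF x y] in \<open>simp add: q_def\<close>)
  have "(q \<longlongrightarrow> Inf (q ` {0<..})) (at_right 0)"
  proof (rule order_tendstoI)
    fix a assume a: "a < Inf (q ` {0<..})"
    show "\<forall>\<^sub>F t in at_right 0. a < q t"
      using eventually_at_right_less[of 0]
    proof eventually_elim
      case (elim t)
      then show ?case using a cINF_lower[OF bdd, of t] by simp
    qed
  next
    fix a assume "Inf (q ` {0<..}) < a"
    then obtain s where s: "0 < s" "q s < a"
      using cInf_lessD[of "q ` {0<..}" a] by fastforce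
    have "\<forall>\<^sub>F t in at_right 0. t \<in> {0<..<s}"
      using s(1) by (rule eventually_at_right_real)
    then show "\<forall>\<^sub>F t in at_right 0. q t < a"
    proof eventually_elim
      case (elim t)
      then show ?case using quotient_mono[OF x y, of t s] s by (simp add: q_def)
    qed
  qed
  then show ?thesis unfolding q_def by blast
qed

lemma left_limit_exists:
  assumes x: "x \<in> carrier V" and y: "y \<in> carrier V"
  shows "\<exists>l. ((\<lambda>t. (vnorm V (x \<oplus> of_real t \<odot>\<^bsub>V\<^esub> y) - vnorm V x) / t) \<longlongrightarrow> l) (at_left 0)"
proof -
  have y': "\<ominus> y \<in> carrier V" using y by simp
  have *: "of_real t \<odot>\<^bsub>V\<^esub> (\<ominus> y) = of_real (- t) \<odot>\<^bsub>V\<^esub> y" for t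
    using y smult_minus_one[OF y] smult_assoc1[of "of_real t" "- 1" y] by simp
  obtain l where
    "((\<lambda>t. (vnorm V (x \<oplus> of_real t \<odot>\<^bsub>V\<^esub> (\<ominus> y)) - vnorm V x) / t) \<longlongrightarrow> l) (at_right 0)"
    using right_limit_exists[OF x y'] by blast
  from tendsto_minus[OF this] have
    "((\<lambda>t. (vnorm V (x \<oplus> of_real (- t) \<odot>\<^bsub>V\<^esub> y) - vnorm V x) / - t) \<longlongrightarrow> - l) (at_right 0)"
    unfolding * by simp
  then show ?thesis
    unfolding filterlim_at_left_to_right[of _ _ 0] by auto
qed

lemma rho_plus_limit:
  assumes "x \<in> carrier V" and "y \<in> carrier V"
  shows "((\<lambda>t. (vnorm V (x \<oplus> of_real t \<odot>\<^bsub>V\<^esub> y) - vnorm V x) / t) \<longlongrightarrow> rho_plus V x y) (at_right 0)"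
proof -
  obtain l where l:
    "((\<lambda>t. (vnorm V (x \<oplus> of_real t \<odot>\<^bsub>V\<^esub> y) - vnorm V x) / t) \<longlongrightarrow> l) (at_right 0)"
    using right_limit_exists[OF assms] by blast
  then have "rho_plus V x y = l"
    unfolding rho_plus_def by (intro tendsto_Lim) simp_all
  with l show ?thesis by simp
qed

lemma rho_minus_limit:
  assumes "x \<in> carrier V" and "y \<in> carrier V"
  shows "((\<lambda>t. (vnorm V (x \<oplus> of_real t \<odot>\<^bsub>V\<^esub> y) - vnorm V x) / t) \<longlongrightarrow> rho_minus V x y) (at_left 0)"
proof -
  obtain l where l:
    "((\<lambda>t. (vnorm V (x \<oplus> of_real t \<odot>\<^bsub>V\<^esub> y) - vnorm V x) / t) \<longlongrightarrow> l) (at_left 0)"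
    using left_limit_exists[OF assms] by blast
  then have "rho_minus V x y = l"
    unfolding rho_minus_def by (intro tendsto_Lim) simp_all
  with l show ?thesis by simp
qed

end

lemma linf_sum_simps:
  "carrier (linf_sum d Y) = (\<Pi>\<^sub>E i\<in>{1..d}. carrier (Y i))"
  "\<zero>\<^bsub>linf_sum d Y\<^esub> = (\<lambda>i\<in>{1..d}. \<zero>\<^bsub>Y i\<^esub>)"
  "y \<oplus>\<^bsub>linf_sum d Y\<^esub> z = (\<lambda>i\<in>{1..d}. y i \<oplus>\<^bsub>Y i\<^esub> z i)"
  "c \<odot>\<^bsub>linf_sum d Y\<^esub> y = (\<lambda>i\<in>{1..d}. c \<odot>\<^bsub>Y i\<^esub> y i)"
  "vnorm (linf_sum d Y) y = Max ((\<lambda>i. vnorm (Y i) (y i)) ` {1..d})"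
  by (simp_all add: linf_sum_def Setcompr_eq_image del: atLeastAtMost_iff)

lemma operator_space_simps:
  "carrier (operator_space X Y) = {T \<in> extensional (carrier X). bounded_linear_on X Y T}"
  "\<zero>\<^bsub>operator_space X Y\<^esub> = (\<lambda>x\<in>carrier X. \<zero>\<^bsub>Y\<^esub>)"
  "S \<oplus>\<^bsub>operator_space X Y\<^esub> T = (\<lambda>x\<in>carrier X. S x \<oplus>\<^bsub>Y\<^esub> T x)"
  "c \<odot>\<^bsub>operator_space X Y\<^esub> T = (\<lambda>x\<in>carrier X. c \<odot>\<^bsub>Y\<^esub> T x)"
  "vnorm (operator_space X Y) = opnorm X Y"
  by (simp_all add: operator_space_def)

lemma normed_spaceI:
  fixes V :: "('k::real_or_complex, 'a, 'm) normed_scheme" (structure)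
  assumes "\<And>x y. \<lbrakk>x \<in> carrier V; y \<in> carrier V\<rbrakk> \<Longrightarrow> x \<oplus> y \<in> carrier V"
    and "\<zero> \<in> carrier V"
    and "\<And>c x. x \<in> carrier V \<Longrightarrow> c \<odot>\<^bsub>V\<^esub> x \<in> carrier V"
    and "\<And>x y z. \<lbrakk>x \<in> carrier V; y \<in> carrier V; z \<in> carrier V\<rbrakk>
      \<Longrightarrow> (x \<oplus> y) \<oplus> z = x \<oplus> (y \<oplus> z)"
    and "\<And>x y. \<lbrakk>x \<in> carrier V; y \<in> carrier V\<rbrakk> \<Longrightarrow> x \<oplus> y = y \<oplus> x"
    and "\<And>x. x \<in> carrier V \<Longrightarrow> \<zero> \<oplus> x = x"
    and "\<And>x. x \<in> carrier V \<Longrightarrow> (- 1) \<odot>\<^bsub>V\<^esub> x \<oplus> x = \<zero>"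
    and "\<And>a b x. x \<in> carrier V \<Longrightarrow> (a + b) \<odot>\<^bsub>V\<^esub> x = a \<odot>\<^bsub>V\<^esub> x \<oplus> b \<odot>\<^bsub>V\<^esub> x"
    and "\<And>a x y. \<lbrakk>x \<in> carrier V; y \<in> carrier V\<rbrakk>
      \<Longrightarrow> a \<odot>\<^bsub>V\<^esub> (x \<oplus> y) = a \<odot>\<^bsub>V\<^esub> x \<oplus> a \<odot>\<^bsub>V\<^esub> y"
    and "\<And>a b x. x \<in> carrier V \<Longrightarrow> (a * b) \<odot>\<^bsub>V\<^esub> x = a \<odot>\<^bsub>V\<^esub> (b \<odot>\<^bsub>V\<^esub> x)"
    and "\<And>x. x \<in> carrier V \<Longrightarrow> 1 \<odot>\<^bsub>V\<^esub> x = x"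
    and "\<And>x. x \<in> carrier V \<Longrightarrow> 0 \<le> vnorm V x"
    and "\<And>x. x \<in> carrier V \<Longrightarrow> vnorm V x = 0 \<longleftrightarrow> x = \<zero>"
    and "\<And>c x. x \<in> carrier V \<Longrightarrow> vnorm V (c \<odot>\<^bsub>V\<^esub> x) = norm c * vnorm V x"
    and "\<And>x y. \<lbrakk>x \<in> carrier V; y \<in> carrier V\<rbrakk> \<Longrightarrow> vnorm V (x \<oplus> y) \<le> vnorm V x + vnorm V y"
  shows "normed_space V"
proof (rule normed_space.intro)
  have "\<exists>y\<in>carrier V. y \<oplus> x = \<zero>" if "x \<in> carrier V" for x
    using assms(3)[OF that, of "- 1"] assms(7)[OF that] by blast
  then have "abelian_group V"
    using assms(1,2,4-6) by (intro abelian_groupI)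
  then show "Module.module scalars V"
    using assms(3,8-11) cring_scalars by (intro moduleI) simp_all
  show "normed_space_axioms V"
    using assms(12-15) by unfold_locales simp_all
qed

lemma normed_space_linf_sum:
  assumes d: "1 \<le> d" and Y: "\<And>i. i \<in> {1..d} \<Longrightarrow> normed_space (Y i)"
  shows "normed_space (linf_sum d Y)"
proof -
  note m = Y[THEN normed_space.axioms(1)]
  note ag = m[THEN module.axioms(2)]
  note am = ag[THEN abelian_group.axioms(1)]
  have ne: "{1..d} \<noteq> {}" using d by auto
  have ext: "y = z" if "y \<in> carrier (linf_sum d Y)" "z \<in> carrier (linf_sum d Y)"
    "\<And>i. i \<in> {1..d} \<Longrightarrow> y i = z i" for y z
    using that unfolding linf_sum_simps by (rule PiE_ext)
  have mem: "y i \<in> carrier (Y i)" if "y \<in> carrier (linf_sum d Y)" "i \<in> {1..d}" for y i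
    using that by (auto simp: linf_sum_simps)
  have le: "vnorm (Y i) (y i) \<le> vnorm (linf_sum d Y) y" if "i \<in> {1..d}" for y i
    unfolding linf_sum_simps using that by (intro Max_ge) auto
  have att: "\<exists>i\<in>{1..d}. vnorm (linf_sum d Y) y = vnorm (Y i) (y i)" for y
  proof -
    have "vnorm (linf_sum d Y) y \<in> (\<lambda>i. vnorm (Y i) (y i)) ` {1..d}"
      unfolding linf_sum_simps using ne by (intro Max_in) auto
    then show ?thesis by blast
  qed
  have add: "y \<oplus>\<^bsub>linf_sum d Y\<^esub> z \<in> carrier (linf_sum d Y)"
    if "y \<in> carrier (linf_sum d Y)" "z \<in> carrier (linf_sum d Y)" for y z
    using mem[OF that(1)] mem[OF that(2)] abelian_monoid.a_closed[OF am]
    by (auto simp: linf_sum_simps)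
  have zero: "\<zero>\<^bsub>linf_sum d Y\<^esub> \<in> carrier (linf_sum d Y)"
    using abelian_monoid.zero_closed[OF am] by (auto simp: linf_sum_simps)
  have smult: "c \<odot>\<^bsub>linf_sum d Y\<^esub> y \<in> carrier (linf_sum d Y)"
    if "y \<in> carrier (linf_sum d Y)" for c y
    using mem[OF that] module.smult_closed[OF m] by (auto simp: linf_sum_simps)
  have idx: "(y \<oplus>\<^bsub>linf_sum d Y\<^esub> z) i = y i \<oplus>\<^bsub>Y i\<^esub> z i"
    "(c \<odot>\<^bsub>linf_sum d Y\<^esub> y) i = c \<odot>\<^bsub>Y i\<^esub> y i"
    "\<zero>\<^bsub>linf_sum d Y\<^esub> i = \<zero>\<^bsub>Y i\<^esub>" if "i \<in> {1..d}" for y z c i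
    using that by (simp_all add: linf_sum_simps)
  have nonneg: "0 \<le> vnorm (linf_sum d Y) y" if "y \<in> carrier (linf_sum d Y)" for y
    using att[of y] normed_space.vnorm_nonneg[OF Y] mem[OF that] by auto
  show ?thesis
  proof (rule normed_spaceI)
    fix x y z assume x: "x \<in> carrier (linf_sum d Y)" and y: "y \<in> carrier (linf_sum d Y)"
      and z: "z \<in> carrier (linf_sum d Y)"
    show "x \<oplus>\<^bsub>linf_sum d Y\<^esub> y \<oplus>\<^bsub>linf_sum d Y\<^esub> z
        = x \<oplus>\<^bsub>linf_sum d Y\<^esub> (y \<oplus>\<^bsub>linf_sum d Y\<^esub> z)"
      by (rule ext) (use x y z add mem am in \<open>auto simp: idx abelian_monoid.a_assoc\<close>)
  next
    fix x y assume x: "x \<in> carrier (linf_sum d Y)" and y: "y \<in> carrier (linf_sum d Y)"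
    show "x \<oplus>\<^bsub>linf_sum d Y\<^esub> y = y \<oplus>\<^bsub>linf_sum d Y\<^esub> x"
      by (rule ext) (use x y add mem am in \<open>auto simp: idx abelian_monoid.a_comm\<close>)
    show "a \<odot>\<^bsub>linf_sum d Y\<^esub> (x \<oplus>\<^bsub>linf_sum d Y\<^esub> y)
        = a \<odot>\<^bsub>linf_sum d Y\<^esub> x \<oplus>\<^bsub>linf_sum d Y\<^esub> a \<odot>\<^bsub>linf_sum d Y\<^esub> y" for a
      by (rule ext) (use x y add smult mem module.smult_r_distr[OF m] in \<open>auto simp: idx\<close>)
    obtain i where i: "i \<in> {1..d}" "vnorm (linf_sum d Y) (x \<oplus>\<^bsub>linf_sum d Y\<^esub> y)
        = vnorm (Y i) ((x \<oplus>\<^bsub>linf_sum d Y\<^esub> y) i)"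
      using att by blast
    show "vnorm (linf_sum d Y) (x \<oplus>\<^bsub>linf_sum d Y\<^esub> y)
        \<le> vnorm (linf_sum d Y) x + vnorm (linf_sum d Y) y"
      using normed_space.vnorm_triangle[OF Y[OF i(1)] mem[OF x i(1)] mem[OF y i(1)]]
        le[OF i(1), of x] le[OF i(1), of y] i(2) idx(1)[OF i(1), of x y] by simp
  next
    fix x assume x: "x \<in> carrier (linf_sum d Y)"
    show "\<zero>\<^bsub>linf_sum d Y\<^esub> \<oplus>\<^bsub>linf_sum d Y\<^esub> x = x"
      by (rule ext) (use x add zero mem am in \<open>auto simp: idx abelian_monoid.l_zero\<close>)
    show "(a + b) \<odot>\<^bsub>linf_sum d Y\<^esub> x
        = a \<odot>\<^bsub>linf_sum d Y\<^esub> x \<oplus>\<^bsub>linf_sum d Y\<^esub> b \<odot>\<^bsub>linf_sum d Y\<^esub> x" for a b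
      by (rule ext) (use x add smult mem module.smult_l_distr[OF m] in \<open>auto simp: idx\<close>)
    show "(a * b) \<odot>\<^bsub>linf_sum d Y\<^esub> x = a \<odot>\<^bsub>linf_sum d Y\<^esub> (b \<odot>\<^bsub>linf_sum d Y\<^esub> x)" for a b
      by (rule ext) (use x smult mem module.smult_assoc1[OF m] in \<open>auto simp: idx\<close>)
    show "1 \<odot>\<^bsub>linf_sum d Y\<^esub> x = x"
      by (rule ext) (use x smult mem module.smult_one[OF m] in \<open>auto simp: idx\<close>)
    show "(- 1) \<odot>\<^bsub>linf_sum d Y\<^esub> x \<oplus>\<^bsub>linf_sum d Y\<^esub> x = \<zero>\<^bsub>linf_sum d Y\<^esub>"
      by (rule ext) (use x add zero smult mem normed_space.smult_minus_one[OF Y]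
          abelian_group.l_neg[OF ag] in \<open>auto simp: idx\<close>)
    show "vnorm (linf_sum d Y) x = 0 \<longleftrightarrow> x = \<zero>\<^bsub>linf_sum d Y\<^esub>"
    proof
      assume 0: "vnorm (linf_sum d Y) x = 0"
      have "x i = \<zero>\<^bsub>Y i\<^esub>" if "i \<in> {1..d}" for i
        using le[OF that, of x] 0 normed_space.vnorm_nonneg[OF Y[OF that] mem[OF x that]]
          normed_space.vnorm_eq_0_iff[OF Y[OF that] mem[OF x that]] by simp
      then show "x = \<zero>\<^bsub>linf_sum d Y\<^esub>"
        by (intro ext x zero) (simp add: idx)
    next
      assume 0: "x = \<zero>\<^bsub>linf_sum d Y\<^esub>"
      obtain i where i: "i \<in> {1..d}" "vnorm (linf_sum d Y) x = vnorm (Y i) (x i)"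
        using att by blast
      then show "vnorm (linf_sum d Y) x = 0"
        using 0 idx(3)[OF i(1)] normed_space.vnorm_eq_0_iff[OF Y[OF i(1)] mem[OF x i(1)]] by simp
    qed
    fix c
    have eq: "vnorm (Y i) ((c \<odot>\<^bsub>linf_sum d Y\<^esub> x) i) = norm c * vnorm (Y i) (x i)"
      if "i \<in> {1..d}" for i
      using normed_space.vnorm_smult[OF Y[OF that] mem[OF x that]] idx(2)[OF that] by simp
    show "vnorm (linf_sum d Y) (c \<odot>\<^bsub>linf_sum d Y\<^esub> x) = norm c * vnorm (linf_sum d Y) x"
    proof (rule antisym)
      obtain i where "i \<in> {1..d}" "vnorm (linf_sum d Y) (c \<odot>\<^bsub>linf_sum d Y\<^esub> x)
          = vnorm (Y i) ((c \<odot>\<^bsub>linf_sum d Y\<^esub> x) i)"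
        using att by blast
      then show "vnorm (linf_sum d Y) (c \<odot>\<^bsub>linf_sum d Y\<^esub> x) \<le> norm c * vnorm (linf_sum d Y) x"
        using eq le by (simp add: mult_left_mono)
      obtain i where "i \<in> {1..d}" "vnorm (linf_sum d Y) x = vnorm (Y i) (x i)"
        using att by blast
      then show "norm c * vnorm (linf_sum d Y) x \<le> vnorm (linf_sum d Y) (c \<odot>\<^bsub>linf_sum d Y\<^esub> x)"
        using eq le by metis
    qed
  qed (use add zero smult nonneg in auto)
qed

locale normed_space_pair = X: normed_space X + Y: normed_space Y
  for X :: "('k::real_or_complex, 'a) normed" and Y :: "('k, 'b) normed"
begin

abbreviation "L \<equiv> operator_space X Y"

lemma op_ext:
  "\<lbrakk>S \<in> carrier L; T \<in> carrier L; \<And>x. x \<in> carrier X \<Longrightarrow> S x = T x\<rbrakk> \<Longrightarrow> S = T"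
  by (auto simp: operator_space_simps intro: extensionalityI)

lemma op_closed: "\<lbrakk>T \<in> carrier L; x \<in> carrier X\<rbrakk> \<Longrightarrow> T x \<in> carrier Y"
  by (auto simp: operator_space_simps bounded_linear_on_def)

lemma op_add:
  "\<lbrakk>T \<in> carrier L; x \<in> carrier X; y \<in> carrier X\<rbrakk> \<Longrightarrow> T (x \<oplus>\<^bsub>X\<^esub> y) = T x \<oplus>\<^bsub>Y\<^esub> T y"
  by (auto simp: operator_space_simps bounded_linear_on_def)

lemma op_smult:
  "\<lbrakk>T \<in> carrier L; x \<in> carrier X\<rbrakk> \<Longrightarrow> T (c \<odot>\<^bsub>X\<^esub> x) = c \<odot>\<^bsub>Y\<^esub> T x"
  by (auto simp: operator_space_simps bounded_linear_on_def)

lemma op_zero: "T \<in> carrier L \<Longrightarrow> T \<zero>\<^bsub>X\<^esub> = \<zero>\<^bsub>Y\<^esub>"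
  using op_smult[of T "\<zero>\<^bsub>X\<^esub>" 0] X.smult_zero_left[of "\<zero>\<^bsub>X\<^esub>"] Y.smult_zero_left op_closed
  by simp

lemma op_bounded:
  assumes "T \<in> carrier L"
  obtains K where "0 \<le> K" "\<And>x. x \<in> carrier X \<Longrightarrow> vnorm Y (T x) \<le> K * vnorm X x"
proof -
  obtain K where K: "\<And>x. x \<in> carrier X \<Longrightarrow> vnorm Y (T x) \<le> K * vnorm X x"
    using assms unfolding operator_space_simps bounded_linear_on_def by blast
  have "vnorm Y (T x) \<le> \<bar>K\<bar> * vnorm X x" if "x \<in> carrier X" for x
    using K[OF that] mult_right_mono[OF abs_ge_self[of K] X.vnorm_nonneg[OF that]] by linarith
  then show ?thesis
    using that[of "\<bar>K\<bar>"] by auto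
qed

lemma opnorm_upper:
  assumes T: "T \<in> carrier L" and x: "x \<in> carrier X" "vnorm X x \<le> 1"
  shows "vnorm Y (T x) \<le> opnorm X Y T"
proof -
  obtain K where K: "0 \<le> K" "\<And>x. x \<in> carrier X \<Longrightarrow> vnorm Y (T x) \<le> K * vnorm X x"
    using op_bounded[OF T] by blast
  have "bdd_above ((\<lambda>x. vnorm Y (T x)) ` {x \<in> carrier X. vnorm X x \<le> 1})"
  proof (rule bdd_aboveI2)
    fix x assume "x \<in> {x \<in> carrier X. vnorm X x \<le> 1}"
    then show "vnorm Y (T x) \<le> K"
      using K(2)[of x] mult_left_mono[of "vnorm X x" 1 K] K(1) by simp
  qed
  then show ?thesis
    unfolding opnorm_def using x by (intro cSUP_upper) auto
qed

lemma opnorm_least: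
  assumes "\<And>x. \<lbrakk>x \<in> carrier X; vnorm X x \<le> 1\<rbrakk> \<Longrightarrow> vnorm Y (T x) \<le> B"
  shows "opnorm X Y T \<le> B"
proof -
  have "\<zero>\<^bsub>X\<^esub> \<in> {x \<in> carrier X. vnorm X x \<le> 1}"
    using X.vnorm_eq_0_iff[of "\<zero>\<^bsub>X\<^esub>"] by simp
  then show ?thesis
    unfolding opnorm_def using assms by (intro cSUP_least) blast+
qed

lemma opnorm_nonneg: "T \<in> carrier L \<Longrightarrow> 0 \<le> opnorm X Y T"
  using opnorm_upper[of T "\<zero>\<^bsub>X\<^esub>"] X.vnorm_eq_0_iff[of "\<zero>\<^bsub>X\<^esub>"]
    Y.vnorm_nonneg[of "T \<zero>\<^bsub>X\<^esub>"] op_closed[of T "\<zero>\<^bsub>X\<^esub>"] by simp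

lemma opnorm_bound:
  assumes T: "T \<in> carrier L" and x: "x \<in> carrier X"
  shows "vnorm Y (T x) \<le> opnorm X Y T * vnorm X x"
proof (cases "vnorm X x = 0")
  case True
  then have "T x = \<zero>\<^bsub>Y\<^esub>"
    using X.vnorm_eq_0_iff[OF x] op_zero[OF T] by simp
  then show ?thesis
    using True Y.vnorm_eq_0_iff[of "\<zero>\<^bsub>Y\<^esub>"] by simp
next
  case False
  define r where "r = vnorm X x"
  have r: "0 < r" using False X.vnorm_nonneg[OF x] by (simp add: r_def)
  let ?c = "of_real (1 / r) :: 'k"
  have c: "norm ?c = 1 / r" using r by (simp only: norm_of_real) simp
  have "vnorm Y (T (?c \<odot>\<^bsub>X\<^esub> x)) \<le> opnorm X Y T"
    using r c X.vnorm_smult[OF x, of ?c] X.smult_closed[of ?c x] x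
    by (intro opnorm_upper[OF T]) (simp_all add: r_def)
  also have "vnorm Y (T (?c \<odot>\<^bsub>X\<^esub> x)) = vnorm Y (T x) / r"
    using op_smult[OF T x, of ?c] Y.vnorm_smult[OF op_closed[OF T x], of ?c] c by simp
  finally show ?thesis
    using r by (simp add: r_def field_simps)
qed

lemma add_closed:
  assumes S: "S \<in> carrier L" and T: "T \<in> carrier L"
  shows "S \<oplus>\<^bsub>L\<^esub> T \<in> carrier L"
proof -
  obtain K where K: "\<And>x. x \<in> carrier X \<Longrightarrow> vnorm Y (S x) \<le> K * vnorm X x"
    using op_bounded[OF S] by blast
  obtain M where M: "\<And>x. x \<in> carrier X \<Longrightarrow> vnorm Y (T x) \<le> M * vnorm X x"
    using op_bounded[OF T] by blast
  have "vnorm Y (S x \<oplus>\<^bsub>Y\<^esub> T x) \<le> (K + M) * vnorm X x" if "x \<in> carrier X" for x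
    using Y.vnorm_triangle[OF op_closed[OF S that] op_closed[OF T that]] K[OF that] M[OF that]
    by (simp add: distrib_right)
  moreover have "S x \<oplus>\<^bsub>Y\<^esub> S y \<oplus>\<^bsub>Y\<^esub> (T x \<oplus>\<^bsub>Y\<^esub> T y) = S x \<oplus>\<^bsub>Y\<^esub> T x \<oplus>\<^bsub>Y\<^esub> (S y \<oplus>\<^bsub>Y\<^esub> T y)"
    if "x \<in> carrier X" "y \<in> carrier X" for x y
    using that op_closed[OF S] op_closed[OF T] by (simp add: Y.M.a_ac)
  moreover have "c \<odot>\<^bsub>Y\<^esub> (S x \<oplus>\<^bsub>Y\<^esub> T x) = c \<odot>\<^bsub>Y\<^esub> S x \<oplus>\<^bsub>Y\<^esub> c \<odot>\<^bsub>Y\<^esub> T x"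
    if "x \<in> carrier X" for x c
    using Y.smult_r_distr[of c "S x" "T x"] that op_closed[OF S] op_closed[OF T] by simp
  moreover have "c \<odot>\<^bsub>X\<^esub> x \<in> carrier X" if "x \<in> carrier X" for x c
    using that X.smult_closed[of c x] by simp
  ultimately show ?thesis
    using op_closed[OF S] op_closed[OF T] op_add[OF S] op_add[OF T] op_smult[OF S] op_smult[OF T]
    unfolding operator_space_simps bounded_linear_on_def by auto
qed

lemma smult_closed:
  assumes T: "T \<in> carrier L"
  shows "c \<odot>\<^bsub>L\<^esub> T \<in> carrier L"
proof -
  obtain K where K: "\<And>x. x \<in> carrier X \<Longrightarrow> vnorm Y (T x) \<le> K * vnorm X x"
    using op_bounded[OF T] by blast
  have "vnorm Y (c \<odot>\<^bsub>Y\<^esub> T x) \<le> (norm c * K) * vnorm X x" if "x \<in> carrier X" for x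
    using Y.vnorm_smult[OF op_closed[OF T that], of c] mult_left_mono[OF K[OF that], of "norm c"]
    by (simp add: mult.assoc)
  moreover have "c \<odot>\<^bsub>Y\<^esub> (T x \<oplus>\<^bsub>Y\<^esub> T y) = c \<odot>\<^bsub>Y\<^esub> T x \<oplus>\<^bsub>Y\<^esub> c \<odot>\<^bsub>Y\<^esub> T y"
    if "x \<in> carrier X" "y \<in> carrier X" for x y
    using Y.smult_r_distr[of c "T x" "T y"] that op_closed[OF T] by simp
  moreover have "c \<odot>\<^bsub>Y\<^esub> (b \<odot>\<^bsub>Y\<^esub> T x) = b \<odot>\<^bsub>Y\<^esub> (c \<odot>\<^bsub>Y\<^esub> T x)" if "x \<in> carrier X" for x b
    using Y.smult_assoc1[of c b "T x"] Y.smult_assoc1[of b c "T x"] that op_closed[OF T]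
    by (simp add: mult.commute)
  moreover have "b \<odot>\<^bsub>X\<^esub> x \<in> carrier X" if "x \<in> carrier X" for x b
    using that X.smult_closed[of b x] by simp
  moreover have "c \<odot>\<^bsub>Y\<^esub> T x \<in> carrier Y" if "x \<in> carrier X" for x
    using that op_closed[OF T] Y.smult_closed[of c "T x"] by simp
  ultimately show ?thesis
    using op_add[OF T] op_smult[OF T]
    unfolding operator_space_simps bounded_linear_on_def by auto
qed

lemma zero_closed: "\<zero>\<^bsub>L\<^esub> \<in> carrier L"
proof -
  have "c \<odot>\<^bsub>X\<^esub> x \<in> carrier X" if "x \<in> carrier X" for x c
    using that X.smult_closed[of c x] by simp
  moreover have "c \<odot>\<^bsub>Y\<^esub> \<zero>\<^bsub>Y\<^esub> = \<zero>\<^bsub>Y\<^esub>" for c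
    using Y.smult_r_null[of c] by simp
  moreover have "vnorm Y \<zero>\<^bsub>Y\<^esub> \<le> 0 * vnorm X x" for x
    using Y.vnorm_eq_0_iff[of "\<zero>\<^bsub>Y\<^esub>"] by simp
  ultimately show ?thesis
    unfolding operator_space_simps bounded_linear_on_def by (auto intro!: exI[of _ 0])
qed

lemma op_apply:
  assumes "x \<in> carrier X"
  shows "(S \<oplus>\<^bsub>L\<^esub> T) x = S x \<oplus>\<^bsub>Y\<^esub> T x" "(c \<odot>\<^bsub>L\<^esub> T) x = c \<odot>\<^bsub>Y\<^esub> T x" "\<zero>\<^bsub>L\<^esub> x = \<zero>\<^bsub>Y\<^esub>"
  using assms by (simp_all add: operator_space_simps)

lemma normed_space_operator_space: "normed_space L"
proof (rule normed_spaceI)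
  fix R S T assume R: "R \<in> carrier L" and S: "S \<in> carrier L" and T: "T \<in> carrier L"
  show "R \<oplus>\<^bsub>L\<^esub> S \<oplus>\<^bsub>L\<^esub> T = R \<oplus>\<^bsub>L\<^esub> (S \<oplus>\<^bsub>L\<^esub> T)"
    by (rule op_ext) (use R S T add_closed op_closed in \<open>auto simp: op_apply Y.M.a_assoc\<close>)
next
  fix S T assume S: "S \<in> carrier L" and T: "T \<in> carrier L"
  show "S \<oplus>\<^bsub>L\<^esub> T = T \<oplus>\<^bsub>L\<^esub> S"
    by (rule op_ext) (use S T add_closed op_closed in \<open>auto simp: op_apply Y.M.a_comm\<close>)
  show "c \<odot>\<^bsub>L\<^esub> (S \<oplus>\<^bsub>L\<^esub> T) = c \<odot>\<^bsub>L\<^esub> S \<oplus>\<^bsub>L\<^esub> c \<odot>\<^bsub>L\<^esub> T" for c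
    by (rule op_ext)
      (use S T add_closed smult_closed op_closed Y.smult_r_distr in \<open>auto simp: op_apply\<close>)
  show "vnorm L (S \<oplus>\<^bsub>L\<^esub> T) \<le> vnorm L S + vnorm L T"
    unfolding operator_space_simps(5)
  proof (rule opnorm_least)
    fix x assume x: "x \<in> carrier X" "vnorm X x \<le> 1"
    show "vnorm Y ((S \<oplus>\<^bsub>L\<^esub> T) x) \<le> opnorm X Y S + opnorm X Y T"
      using Y.vnorm_triangle[OF op_closed[OF S x(1)] op_closed[OF T x(1)]]
        opnorm_upper[OF S x] opnorm_upper[OF T x] op_apply(1)[OF x(1), of S T] by simp
  qed
next
  fix T assume T: "T \<in> carrier L"
  show "\<zero>\<^bsub>L\<^esub> \<oplus>\<^bsub>L\<^esub> T = T"
    by (rule op_ext) (use T add_closed zero_closed op_closed in \<open>auto simp: op_apply\<close>)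
  show "(a + b) \<odot>\<^bsub>L\<^esub> T = a \<odot>\<^bsub>L\<^esub> T \<oplus>\<^bsub>L\<^esub> b \<odot>\<^bsub>L\<^esub> T" for a b
    by (rule op_ext)
      (use T add_closed smult_closed op_closed Y.smult_l_distr in \<open>auto simp: op_apply\<close>)
  show "(a * b) \<odot>\<^bsub>L\<^esub> T = a \<odot>\<^bsub>L\<^esub> (b \<odot>\<^bsub>L\<^esub> T)" for a b
    by (rule op_ext) (use T smult_closed op_closed Y.smult_assoc1 in \<open>auto simp: op_apply\<close>)
  show "1 \<odot>\<^bsub>L\<^esub> T = T"
    by (rule op_ext) (use T smult_closed op_closed Y.smult_one in \<open>auto simp: op_apply\<close>)
  show "(- 1) \<odot>\<^bsub>L\<^esub> T \<oplus>\<^bsub>L\<^esub> T = \<zero>\<^bsub>L\<^esub>"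
    by (rule op_ext) (use T add_closed smult_closed zero_closed op_closed Y.smult_minus_one
        Y.M.l_neg in \<open>auto simp: op_apply\<close>)
  show "0 \<le> vnorm L T"
    using opnorm_nonneg[OF T] by (simp add: operator_space_simps)
  show "vnorm L T = 0 \<longleftrightarrow> T = \<zero>\<^bsub>L\<^esub>"
  proof
    assume "vnorm L T = 0"
    then have "vnorm Y (T x) = 0" if "x \<in> carrier X" for x
      using opnorm_bound[OF T that] Y.vnorm_nonneg[OF op_closed[OF T that]]
      by (simp add: operator_space_simps)
    then show "T = \<zero>\<^bsub>L\<^esub>"
      using Y.vnorm_eq_0_iff op_closed[OF T] by (intro op_ext T zero_closed) (simp add: op_apply)
  next
    assume 0: "T = \<zero>\<^bsub>L\<^esub>"
    have "opnorm X Y T \<le> 0"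
      using 0 Y.vnorm_eq_0_iff[of "\<zero>\<^bsub>Y\<^esub>"] by (intro opnorm_least) (simp add: op_apply)
    then show "vnorm L T = 0"
      using opnorm_nonneg[OF T] by (simp add: operator_space_simps)
  qed
  fix c
  have eq: "vnorm Y ((c \<odot>\<^bsub>L\<^esub> T) x) = norm c * vnorm Y (T x)" if "x \<in> carrier X" for x
    using Y.vnorm_smult[OF op_closed[OF T that], of c] op_apply(2)[OF that, of c T] by simp
  have "opnorm X Y (c \<odot>\<^bsub>L\<^esub> T) \<le> norm c * opnorm X Y T"
    using opnorm_upper[OF T] by (intro opnorm_least) (simp add: eq mult_left_mono)
  moreover have "norm c * opnorm X Y T \<le> opnorm X Y (c \<odot>\<^bsub>L\<^esub> T)"
  proof (cases "c = 0")
    case True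
    then show ?thesis using opnorm_nonneg[OF smult_closed[OF T, of c]] by simp
  next
    case False
    have "opnorm X Y T \<le> opnorm X Y (c \<odot>\<^bsub>L\<^esub> T) / norm c"
      using opnorm_upper[OF smult_closed[OF T, of c]] eq False
      by (intro opnorm_least) (simp add: field_simps)
    then show ?thesis using False by (simp add: field_simps)
  qed
  ultimately show "vnorm L (c \<odot>\<^bsub>L\<^esub> T) = norm c * vnorm L T"
    by (simp add: operator_space_simps)
qed (use add_closed smult_closed zero_closed in auto)

end

text \<open>This justifies identifying a tuple of operators with an operator into the direct sum.\<close>

lemma bij_betw_tuple_operator:
  assumes d: "1 \<le> d" and X: "normed_space X"
    and Y: "\<And>i. i \<in> {1..d} \<Longrightarrow> normed_space (Y i)"
  shows "bij_betw (tuple_operator X d) (\<Pi>\<^sub>E i\<in>{1..d}. carrier (operator_space X (Y i)))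
           (carrier (operator_space X (linf_sum d Y)))"
proof -
  have pair: "normed_space_pair X (Y i)" if "i \<in> {1..d}" for i
    using X Y[OF that] by (simp add: normed_space_pair_def)
  interpret Z: normed_space_pair X "linf_sum d Y"
    using X normed_space_linf_sum[OF d Y] by (simp add: normed_space_pair_def)
  have ne: "{1..d} \<noteq> {}" using d by auto
  have to: "tuple_operator X d T \<in> carrier (operator_space X (linf_sum d Y))"
    if T: "T \<in> (\<Pi>\<^sub>E i\<in>{1..d}. carrier (operator_space X (Y i)))" for T
  proof -
    have Ti: "T i \<in> carrier (operator_space X (Y i))" if "i \<in> {1..d}" for i
      using T that by blast
    have "\<exists>K. 0 \<le> K \<and> (\<forall>x\<in>carrier X. vnorm (Y i) (T i x) \<le> K * vnorm X x)" if "i \<in> {1..d}" for i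
      using normed_space_pair.op_bounded[OF pair[OF that] Ti[OF that]] by metis
    then obtain K where K: "\<And>i. i \<in> {1..d} \<Longrightarrow> 0 \<le> K i"
      "\<And>i x. i \<in> {1..d} \<Longrightarrow> x \<in> carrier X \<Longrightarrow> vnorm (Y i) (T i x) \<le> K i * vnorm X x"
      by metis
    have bound: "vnorm (linf_sum d Y) (\<lambda>i\<in>{1..d}. T i x) \<le> sum K {1..d} * vnorm X x"
      if x: "x \<in> carrier X" for x
      unfolding linf_sum_simps
    proof (rule Max.boundedI)
      fix a assume "a \<in> (\<lambda>i. vnorm (Y i) ((\<lambda>i\<in>{1..d}. T i x) i)) ` {1..d}"
      then obtain i where i: "i \<in> {1..d}" "a = vnorm (Y i) (T i x)"
        by auto
      have "K i \<le> sum K {1..d}"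
        using i(1) K(1) by (intro member_le_sum) auto
      then show "a \<le> sum K {1..d} * vnorm X x"
        using K(2)[OF i(1) x] i(2) normed_space.vnorm_nonneg[OF X x]
          mult_right_mono[of "K i" "sum K {1..d}" "vnorm X x"] by linarith
    qed (use ne in auto)
    have "bounded_linear_on X (linf_sum d Y) (tuple_operator X d T)"
      unfolding bounded_linear_on_def
    proof (intro conjI ballI allI)
      show "tuple_operator X d T \<in> carrier X \<rightarrow> carrier (linf_sum d Y)"
        using normed_space_pair.op_closed[OF pair Ti]
        by (auto simp: tuple_operator_def linf_sum_simps)
      show "tuple_operator X d T (x \<oplus>\<^bsub>X\<^esub> y)
          = tuple_operator X d T x \<oplus>\<^bsub>linf_sum d Y\<^esub> tuple_operator X d T y"
        if "x \<in> carrier X" "y \<in> carrier X" for x y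
        using that normed_space_pair.op_add[OF pair Ti]
        by (auto simp: tuple_operator_def linf_sum_simps intro!: restrict_ext)
      show "tuple_operator X d T (c \<odot>\<^bsub>X\<^esub> x) = c \<odot>\<^bsub>linf_sum d Y\<^esub> tuple_operator X d T x"
        if "x \<in> carrier X" for x c
        using that normed_space_pair.op_smult[OF pair Ti] Z.X.smult_closed[of c x]
        by (auto simp: tuple_operator_def linf_sum_simps intro!: restrict_ext)
      show "\<exists>K. \<forall>x\<in>carrier X. vnorm (linf_sum d Y) (tuple_operator X d T x) \<le> K * vnorm X x"
        using bound by (auto simp: tuple_operator_def)
    qed
    then show ?thesis
      by (simp add: operator_space_simps tuple_operator_def)
  qed
  define p where "p = (\<lambda>R. \<lambda>i\<in>{1..d}. \<lambda>x\<in>carrier X. R x i :: 'c)"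
  have from_sum: "p R \<in> (\<Pi>\<^sub>E i\<in>{1..d}. carrier (operator_space X (Y i)))"
    if R: "R \<in> carrier (operator_space X (linf_sum d Y))" for R
  proof -
    obtain K where K: "0 \<le> K"
      "\<And>x. x \<in> carrier X \<Longrightarrow> vnorm (linf_sum d Y) (R x) \<le> K * vnorm X x"
      using Z.op_bounded[OF R] by blast
    have "p R i \<in> carrier (operator_space X (Y i))" if i: "i \<in> {1..d}" for i
    proof -
      have "bounded_linear_on X (Y i) (p R i)"
        unfolding bounded_linear_on_def
      proof (intro conjI ballI allI)
        show "p R i \<in> carrier X \<rightarrow> carrier (Y i)"
          using PiE_mem[OF Z.op_closed[OF R, unfolded linf_sum_simps] i] i
          by (auto simp: p_def)
        show "p R i (x \<oplus>\<^bsub>X\<^esub> y) = p R i x \<oplus>\<^bsub>Y i\<^esub> p R i y"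
          if "x \<in> carrier X" "y \<in> carrier X" for x y
          using that i Z.op_add[OF R that] by (simp add: p_def linf_sum_simps)
        show "p R i (c \<odot>\<^bsub>X\<^esub> x) = c \<odot>\<^bsub>Y i\<^esub> p R i x" if "x \<in> carrier X" for x c
          using that i Z.op_smult[OF R that] Z.X.smult_closed[of c x]
          by (simp add: p_def linf_sum_simps)
        have "vnorm (Y i) (p R i x) \<le> K * vnorm X x" if x: "x \<in> carrier X" for x
        proof -
          have "vnorm (Y i) (R x i) \<le> vnorm (linf_sum d Y) (R x)"
            unfolding linf_sum_simps using i by (intro Max_ge) auto
          then show ?thesis
            using K(2)[OF x] i x by (simp add: p_def)
        qed
        then show "\<exists>K. \<forall>x\<in>carrier X. vnorm (Y i) (p R i x) \<le> K * vnorm X x"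
          by blast
      qed
      then show ?thesis
        using i by (simp add: operator_space_simps p_def)
    qed
    then show ?thesis
      unfolding PiE_iff by (simp add: p_def)
  qed
  show ?thesis
  proof (rule bij_betw_byWitness[where f' = p])
    show "\<forall>T\<in>(\<Pi>\<^sub>E i\<in>{1..d}. carrier (operator_space X (Y i))). p (tuple_operator X d T) = T"
    proof
      fix T assume T: "T \<in> (\<Pi>\<^sub>E i\<in>{1..d}. carrier (operator_space X (Y i)))"
      show "p (tuple_operator X d T) = T"
      proof (rule PiE_ext[OF from_sum[OF to[OF T]] T])
        fix i assume i: "i \<in> {1..d}"
        have "T i \<in> extensional (carrier X)"
          using PiE_mem[OF T i] by (simp add: operator_space_simps)
        then show "p (tuple_operator X d T) i = T i"
          using i by (auto simp: p_def tuple_operator_def extensional_def fun_eq_iff)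
      qed
    qed
    show "\<forall>R\<in>carrier (operator_space X (linf_sum d Y)). tuple_operator X d (p R) = R"
    proof
      fix R assume R: "R \<in> carrier (operator_space X (linf_sum d Y))"
      show "tuple_operator X d (p R) = R"
      proof (rule Z.op_ext[OF to[OF from_sum[OF R]] R])
        fix x assume x: "x \<in> carrier X"
        have "R x \<in> extensional {1..d}"
          using Z.op_closed[OF R x] by (simp add: linf_sum_simps PiE_def)
        then show "tuple_operator X d (p R) x = R x"
          using x by (auto simp: p_def tuple_operator_def extensional_def fun_eq_iff)
      qed
    qed
  qed (use to from_sum in blast)+
qed

end

theory Submission
  imports Defs
begin

text \<open>
  The operator norm of a tuple is the largest of the operator norms of its entries, since two
  suprema can be exchanged (\<open>opnorm_tuple_operator\<close>), and forming a tuple commutes with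
  the vector operations. Therefore \<open>t \<mapsto> \<parallel>\<T> + t\<S>\<parallel>\<close> is the pointwise maximum of
  the finitely many real functions \<open>t \<mapsto> \<parallel>T\<^sub>i + t S\<^sub>i\<parallel>\<close>, and the theorem is a statement about
  one-sided derivatives of such a maximum (Danskin's formula): only the functions that attain the
  maximum at \<open>0\<close> can attain it near \<open>0\<close>, because those below it at \<open>0\<close> stay
  below it by continuity. Hence the difference quotient of the maximum is, for small \<open>t > 0\<close>,
  the maximum of the difference quotients of the active functions, and this passes to the limit
  (\<open>Max_right_quotient_tendsto\<close>). Replacing \<open>t\<close> by \<open>- t\<close> reverses the sign of the
  quotients and turns the maximum into a minimum (\<open>Max_left_quotient_tendsto\<close>).
\<close>

lemma tendsto_Max_image:
  fixes f :: "'i \<Rightarrow> 'a \<Rightarrow> 'b::linorder_topology"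
  assumes "finite I" and "I \<noteq> {}" and "\<And>i. i \<in> I \<Longrightarrow> (f i \<longlongrightarrow> l i) F"
  shows "((\<lambda>t. Max ((\<lambda>i. f i t) ` I)) \<longlongrightarrow> Max (l ` I)) F"
  using assms
proof (induction I rule: finite_ne_induct)
  case (singleton i)
  then show ?case by simp
next
  case (insert i I)
  then have "((\<lambda>t. max (f i t) (Max ((\<lambda>i. f i t) ` I))) \<longlongrightarrow> max (l i) (Max (l ` I))) F"
    by (intro tendsto_max) auto
  with insert.hyps show ?case by simp
qed

text \<open>A function with a one-sided difference quotient that converges is continuous from that side,
  so an index below the maximum at \<open>0\<close> cannot compete with an active one for small \<open>t\<close>.\<close>

lemma Max_right_quotient_tendsto:
  fixes f :: "'i \<Rightarrow> real \<Rightarrow> real"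
  assumes fin: "finite I" and ne: "I \<noteq> {}"
    and lim: "\<And>i. i \<in> I \<Longrightarrow> ((\<lambda>t. (f i t - f i 0) / t) \<longlongrightarrow> l i) (at_right 0)"
    and M: "\<And>t. M t = Max ((\<lambda>i. f i t) ` I)"
  shows "((\<lambda>t. (M t - M 0) / t) \<longlongrightarrow> Max (l ` {i \<in> I. f i 0 = M 0})) (at_right 0)"
proof -
  define A where "A = {i \<in> I. f i 0 = M 0}"
  have M_in: "\<exists>i\<in>I. M t = f i t" for t
  proof -
    have "M t \<in> (\<lambda>i. f i t) ` I"
      unfolding M using fin ne by (intro Max_in) auto
    then show ?thesis by blast
  qed
  have M_ge: "f i t \<le> M t" if "i \<in> I" for i t
    unfolding M using fin that by (intro Max_ge) auto
  have A: "finite A" "A \<noteq> {}" "A \<subseteq> I"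
    using fin M_in[of 0] by (auto simp: A_def)
  then obtain j where j: "j \<in> A" by blast
  have cont: "(f i \<longlongrightarrow> f i 0) (at_right 0)" if "i \<in> I" for i
  proof -
    have "((\<lambda>t. (f i t - f i 0) / t * t + f i 0) \<longlongrightarrow> l i * 0 + f i 0) (at_right 0)"
      by (intro tendsto_intros lim that)
    moreover have "\<forall>\<^sub>F t in at_right 0. (f i t - f i 0) / t * t + f i 0 = f i t"
      using eventually_at_right_less[of 0] by eventually_elim simp
    ultimately show ?thesis
      by (simp only: mult_zero_right add_0) (rule Lim_transform_eventually)
  qed
  have inactive: "\<forall>\<^sub>F t in at_right 0. \<forall>i\<in>I - A. f i t < f j t"
  proof (rule eventually_ball_finite)
    show "\<forall>i\<in>I - A. \<forall>\<^sub>F t in at_right 0. f i t < f j t"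
    proof
      fix i assume i: "i \<in> I - A"
      then have "f i 0 < f j 0"
        using M_ge[of i 0] j by (auto simp: A_def)
      moreover have "i \<in> I" "j \<in> I"
        using i j A(3) by auto
      ultimately show "\<forall>\<^sub>F t in at_right 0. f i t < f j t"
        using order_tendstoD(1)[OF tendsto_diff[OF cont[of j] cont[of i]], of 0] by simp
    qed
  qed (use fin in simp)
  (* Active functions share the value M 0 at 0, so dividing by t > 0 preserves their order. *)
  have "\<forall>\<^sub>F t in at_right 0. Max ((\<lambda>i. (f i t - f i 0) / t) ` A) = (M t - M 0) / t"
    using inactive eventually_at_right_less[of 0]
  proof eventually_elim
    case (elim t)
    obtain k where k: "k \<in> I" "M t = f k t"
      using M_in by blast
    have "k \<in> A"
    proof (rule ccontr)
      assume "k \<notin> A"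
      with elim(1) k have "M t < f j t" by simp
      moreover have "f j t \<le> M t" using j A(3) by (intro M_ge) blast
      ultimately show False by simp
    qed
    show ?case
    proof (rule Max_eqI)
      show "y \<le> (M t - M 0) / t" if "y \<in> (\<lambda>i. (f i t - f i 0) / t) ` A" for y
        using that elim(2) M_ge by (auto simp: A_def intro!: divide_right_mono)
      show "(M t - M 0) / t \<in> (\<lambda>i. (f i t - f i 0) / t) ` A"
        using \<open>k \<in> A\<close> k(2) by (intro image_eqI[of _ _ k]) (auto simp: A_def)
    qed (use A in simp)
  qed
  moreover have "((\<lambda>t. Max ((\<lambda>i. (f i t - f i 0) / t) ` A)) \<longlongrightarrow> Max (l ` A)) (at_right 0)"
    using A lim by (intro tendsto_Max_image) auto
  ultimately show ?thesis
    unfolding A_def by (rule Lim_transform_eventually[rotated])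
qed

text \<open>This is the right-sided formula for \<open>t \<mapsto> f i (- t)\<close>, whose derivatives at
  \<open>0\<close> are \<open>- l i\<close>; negating the maximum of these gives the minimum of the
  \<open>l i\<close>.\<close>

lemma Max_left_quotient_tendsto:
  fixes f :: "'i \<Rightarrow> real \<Rightarrow> real"
  assumes fin: "finite I" and ne: "I \<noteq> {}"
    and lim: "\<And>i. i \<in> I \<Longrightarrow> ((\<lambda>t. (f i t - f i 0) / t) \<longlongrightarrow> l i) (at_left 0)"
    and M: "\<And>t. M t = Max ((\<lambda>i. f i t) ` I)"
  shows "((\<lambda>t. (M t - M 0) / t) \<longlongrightarrow> Min (l ` {i \<in> I. f i 0 = M 0})) (at_left 0)"
proof -
  define A where "A = {i \<in> I. f i 0 = M 0}"
  have "M 0 \<in> (\<lambda>i. f i 0) ` I"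
    unfolding M using fin ne by (intro Max_in) auto
  then have A: "finite A" "A \<noteq> {}"
    using fin by (auto simp: A_def)
  have "((\<lambda>t. (f i (- t) - f i (- 0)) / t) \<longlongrightarrow> - l i) (at_right 0)" if "i \<in> I" for i
    using tendsto_minus[OF lim[OF that, unfolded filterlim_at_left_to_right[of _ _ 0]]] by simp
  from Max_right_quotient_tendsto[of I "\<lambda>i t. f i (- t)", OF fin ne this, of "\<lambda>t. M (- t)"]
  have "((\<lambda>t. (M (- t) - M 0) / t) \<longlongrightarrow> Max ((\<lambda>i. - l i) ` A)) (at_right 0)"
    by (simp add: M A_def)
  moreover have "Max ((\<lambda>i. - l i) ` A) = - Min (l ` A)"
    using A by (simp add: minus_Min_eq_Max image_image)
  ultimately have "((\<lambda>t. (M (- t) - M 0) / - t) \<longlongrightarrow> Min (l ` A)) (at_right 0)"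
    using tendsto_minus by fastforce
  then show ?thesis
    unfolding filterlim_at_left_to_right[of _ _ 0] A_def by simp
qed

lemma tuple_operator_closed:
  assumes "1 \<le> d" and "normed_space X" and "\<And>i. i \<in> {1..d} \<Longrightarrow> normed_space (Y i)"
    and R: "\<And>i. i \<in> {1..d} \<Longrightarrow> R i \<in> carrier (operator_space X (Y i))"
  shows "tuple_operator X d R \<in> carrier (operator_space X (linf_sum d Y))"
proof -
  (* The tuples of the bijection are extended by undefined off the index set, unlike R. *)
  have "tuple_operator X d (restrict R {1..d}) \<in> carrier (operator_space X (linf_sum d Y))"
    using bij_betwE[OF bij_betw_tuple_operator[OF assms(1-3)]] R by simp
  moreover have "tuple_operator X d (restrict R {1..d}) = tuple_operator X d R"
    by (simp add: tuple_operator_def cong: restrict_cong)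
  ultimately show ?thesis by simp
qed

text \<open>Both sides are the supremum of \<open>\<parallel>R\<^sub>i x\<parallel>\<close> over all indices \<open>i\<close> and all
  \<open>x\<close> in the unit ball, taken in the two possible orders.\<close>

lemma opnorm_tuple_operator:
  assumes d: "1 \<le> d" and X: "normed_space X"
    and Y: "\<And>i. i \<in> {1..d} \<Longrightarrow> normed_space (Y i)"
    and R: "\<And>i. i \<in> {1..d} \<Longrightarrow> R i \<in> carrier (operator_space X (Y i))"
  shows "opnorm X (linf_sum d Y) (tuple_operator X d R)
    = Max ((\<lambda>i. opnorm X (Y i) (R i)) ` {1..d})" (is "?N = Max ?A")
proof (rule antisym)
  have pair: "normed_space_pair X (Y i)" if "i \<in> {1..d}" for i
    using X Y[OF that] by (simp add: normed_space_pair_def)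
  interpret Z: normed_space_pair X "linf_sum d Y"
    using X normed_space_linf_sum[OF d Y] by (simp add: normed_space_pair_def)
  note tuple = tuple_operator_closed[OF d X Y R]
  have ne: "{1..d} \<noteq> {}" using d by simp
  have norm_eq: "vnorm (linf_sum d Y) (tuple_operator X d R x)
      = Max ((\<lambda>i. vnorm (Y i) (R i x)) ` {1..d})" if "x \<in> carrier X" for x
    using that by (simp add: linf_sum_simps tuple_operator_def)
  show "?N \<le> Max ?A"
  proof (rule Z.opnorm_least)
    fix x assume x: "x \<in> carrier X" "vnorm X x \<le> 1"
    have "vnorm (Y i) (R i x) \<le> Max ?A" if i: "i \<in> {1..d}" for i
      using normed_space_pair.opnorm_upper[OF pair[OF i] R[OF i] x] i
      by (intro order.trans[OF _ Max_ge]) auto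
    then show "vnorm (linf_sum d Y) (tuple_operator X d R x) \<le> Max ?A"
      unfolding norm_eq[OF x(1)] using ne by (intro Max.boundedI) auto
  qed
  show "Max ?A \<le> ?N"
  proof (rule Max.boundedI)
    fix a assume "a \<in> ?A"
    then obtain i where i: "i \<in> {1..d}" "a = opnorm X (Y i) (R i)" by blast
    have "opnorm X (Y i) (R i) \<le> ?N"
    proof (rule normed_space_pair.opnorm_least[OF pair[OF i(1)]])
      fix x assume x: "x \<in> carrier X" "vnorm X x \<le> 1"
      have "vnorm (Y i) (R i x) \<le> vnorm (linf_sum d Y) (tuple_operator X d R x)"
        unfolding norm_eq[OF x(1)] using i(1) by (intro Max_ge) auto
      also have "\<dots> \<le> ?N"
        using tuple x by (rule Z.opnorm_upper)
      finally show "vnorm (Y i) (R i x) \<le> ?N" .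
    qed
    then show "a \<le> ?N" using i(2) by simp
  qed (use ne in auto)
qed

lemma tuple_operator_add_smult:
  "tuple_operator X d T \<oplus>\<^bsub>operator_space X (linf_sum d Y)\<^esub>
     c \<odot>\<^bsub>operator_space X (linf_sum d Y)\<^esub> tuple_operator X d S
   = tuple_operator X d (\<lambda>i. T i \<oplus>\<^bsub>operator_space X (Y i)\<^esub> c \<odot>\<^bsub>operator_space X (Y i)\<^esub> S i)"
  by (auto simp: tuple_operator_def operator_space_simps linf_sum_simps fun_eq_iff)

lemma (in normed_space) add_smult_of_real_0:
  "\<lbrakk>x \<in> carrier V; y \<in> carrier V\<rbrakk> \<Longrightarrow> x \<oplus> of_real 0 \<odot>\<^bsub>V\<^esub> y = x"
  by (simp add: smult_zero_left)

theorem theorem2p14: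
  fixes d :: nat
    and X :: "('k::real_or_complex, 'a) normed"
    and Y :: "nat \<Rightarrow> ('k, 'b) normed"
    and T S :: "nat \<Rightarrow> 'a \<Rightarrow> 'b"
  assumes "1 \<le> d"
    and "banach_space X"
    and "\<And>i. i \<in> {1..d} \<Longrightarrow> banach_space (Y i)"
    and "\<And>i. i \<in> {1..d} \<Longrightarrow> T i \<in> carrier (operator_space X (Y i))"
    and "\<And>i. i \<in> {1..d} \<Longrightarrow> S i \<in> carrier (operator_space X (Y i))"
  shows "rho_plus (operator_space X (linf_sum d Y)) (tuple_operator X d T) (tuple_operator X d S)
      = Max {rho_plus (operator_space X (Y i)) (T i) (S i) | i.
          i \<in> {1..d} \<and>
          opnorm X (Y i) (T i) = opnorm X (linf_sum d Y) (tuple_operator X d T)}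
    \<and> rho_minus (operator_space X (linf_sum d Y)) (tuple_operator X d T) (tuple_operator X d S)
      = Min {rho_minus (operator_space X (Y i)) (T i) (S i) | i.
          i \<in> {1..d} \<and>
          opnorm X (Y i) (T i) = opnorm X (linf_sum d Y) (tuple_operator X d T)}"
proof -
  let ?L = "\<lambda>i. operator_space X (Y i)"
  let ?Z = "operator_space X (linf_sum d Y)"
  define f where "f i t = opnorm X (Y i) (T i \<oplus>\<^bsub>?L i\<^esub> of_real t \<odot>\<^bsub>?L i\<^esub> S i)" for i t
  define M where "M t = opnorm X (linf_sum d Y)
      (tuple_operator X d T \<oplus>\<^bsub>?Z\<^esub> of_real t \<odot>\<^bsub>?Z\<^esub> tuple_operator X d S)" for t
  have Y: "normed_space (Y i)" if "i \<in> {1..d}" for i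
    using assms(3)[OF that] by (rule banach_space.axioms(1))
  have X: "normed_space X"
    using assms(2) by (rule banach_space.axioms(1))
  have pair: "normed_space_pair X (Y i)" if "i \<in> {1..d}" for i
    using X Y[OF that] by (simp add: normed_space_pair_def)
  have L: "normed_space (?L i)" if "i \<in> {1..d}" for i
    using normed_space_pair.normed_space_operator_space[OF pair[OF that]] .
  have entry_closed: "T i \<oplus>\<^bsub>?L i\<^esub> c \<odot>\<^bsub>?L i\<^esub> S i \<in> carrier (?L i)" if "i \<in> {1..d}" for i c
    using normed_space_pair.add_closed[OF pair[OF that]]
      normed_space_pair.smult_closed[OF pair[OF that]] assms(4,5)[OF that] by blast
  interpret Z: normed_space_pair X "linf_sum d Y"
    using X normed_space_linf_sum[OF assms(1) Y] by (simp add: normed_space_pair_def)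
  interpret ZL: normed_space ?Z
    by (rule Z.normed_space_operator_space)
  have T: "tuple_operator X d T \<in> carrier ?Z" and S: "tuple_operator X d S \<in> carrier ?Z"
    using tuple_operator_closed[OF assms(1) X Y] assms(4,5) by auto
  have f0: "f i 0 = opnorm X (Y i) (T i)" if "i \<in> {1..d}" for i
    using normed_space.add_smult_of_real_0[OF L] assms(4,5) that by (simp add: f_def)
  have M0: "M 0 = opnorm X (linf_sum d Y) (tuple_operator X d T)"
    using ZL.add_smult_of_real_0[OF T S] by (simp add: M_def)
  have M: "M t = Max ((\<lambda>i. f i t) ` {1..d})" for t
    unfolding M_def f_def tuple_operator_add_smult
    by (rule opnorm_tuple_operator[OF assms(1) X Y entry_closed])
  have ne: "{1..d} \<noteq> {}" using assms(1) by simp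
  have active: "{g i | i. i \<in> {1..d} \<and>
      opnorm X (Y i) (T i) = opnorm X (linf_sum d Y) (tuple_operator X d T)}
    = g ` {i \<in> {1..d}. f i 0 = M 0}" for g :: "nat \<Rightarrow> real"
    using f0 M0 by auto
  have "((\<lambda>t. (M t - M 0) / t) \<longlongrightarrow> rho_plus ?Z (tuple_operator X d T) (tuple_operator X d S))
      (at_right 0)"
    using ZL.rho_plus_limit[OF T S] by (simp add: M_def[symmetric] M0 operator_space_simps(5))
  moreover have "((\<lambda>t. (f i t - f i 0) / t) \<longlongrightarrow> rho_plus (?L i) (T i) (S i)) (at_right 0)"
    if "i \<in> {1..d}" for i
    using normed_space.rho_plus_limit[OF L assms(4,5)] that
    by (simp add: f_def[symmetric] f0 operator_space_simps(5))
  from Max_right_quotient_tendsto[of "{1..d}" f, OF _ ne this M]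
  have "((\<lambda>t. (M t - M 0) / t)
      \<longlongrightarrow> Max ((\<lambda>i. rho_plus (?L i) (T i) (S i)) ` {i \<in> {1..d}. f i 0 = M 0})) (at_right 0)"
    by simp
  ultimately have plus: "rho_plus ?Z (tuple_operator X d T) (tuple_operator X d S)
      = Max ((\<lambda>i. rho_plus (?L i) (T i) (S i)) ` {i \<in> {1..d}. f i 0 = M 0})"
    by (rule tendsto_unique[rotated]) simp
  have "((\<lambda>t. (M t - M 0) / t) \<longlongrightarrow> rho_minus ?Z (tuple_operator X d T) (tuple_operator X d S))
      (at_left 0)"
    using ZL.rho_minus_limit[OF T S] by (simp add: M_def[symmetric] M0 operator_space_simps(5))
  moreover have "((\<lambda>t. (f i t - f i 0) / t) \<longlongrightarrow> rho_minus (?L i) (T i) (S i)) (at_left 0)"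
    if "i \<in> {1..d}" for i
    using normed_space.rho_minus_limit[OF L assms(4,5)] that
    by (simp add: f_def[symmetric] f0 operator_space_simps(5))
  from Max_left_quotient_tendsto[of "{1..d}" f, OF _ ne this M]
  have "((\<lambda>t. (M t - M 0) / t)
      \<longlongrightarrow> Min ((\<lambda>i. rho_minus (?L i) (T i) (S i)) ` {i \<in> {1..d}. f i 0 = M 0})) (at_left 0)"
    by simp
  ultimately have minus: "rho_minus ?Z (tuple_operator X d T) (tuple_operator X d S)
      = Min ((\<lambda>i. rho_minus (?L i) (T i) (S i)) ` {i \<in> {1..d}. f i 0 = M 0})"
    by (rule tendsto_unique[rotated]) simp
  show ?thesis
    unfolding active using plus minus by blast
qed

end
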